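(* Let $s$ be a weak composition. The $s$-Tamari poset is a sublattice of the $s$-weak order. In particular, it is a lattice.
   Context: A weak composition is a finite sequence $s=(s(1),\dots,s(n))$ of nonnegative integers. An $s$-decreasing tree is a rooted planar tree with exactly $n$ internal nodes, labelled bijectively by $1,\dots,n$ (an internal node is identified with its label; the other nodes are unlabelled leaves), such that internal node $i$ has exactly $s(i)+1$ ordered children and all internal nodes that are descendants of $i$ have labels smaller than $i$. For a node $y$ of $T$, $T^y_0,\dots,T^y_{s(y)}$ denote its child subtrees from left to right, and $x\in T^y_i$ means that internal node $x$ lies in that subtree. If $x<y$ and $x$ is not a descendant of $y$, let $z$ be the first (closest) common ancestor of $x$ and $y$, with $x\in T^z_j$, $y\in T^z_i$, $i\neq j$; $x$ is left of $y$ if $j<i$ and right of $y$ if $j>i$. For $x<y$ the cardinality $\#_T(y,x)$ is: $0$ if $x$ is left of $y$; $i$ if $x\in T^y_i$; $s(y)$ if $x$ is right of $y$. The $s$-weak order is defined by $R\preccurlyeq T$ iff $\#_R(y,x)\le \#_T(y,x)$ for all $1\le x<y\le n$; it is a lattice. An $s$-decreasing tree $T$ is an $s$-Tamari tree if $\#_T(c,a)\le\#_T(c,b)$ for all $1\le a<b<c\le n$. The $s$-Tamari poset is the restriction of the $s$-weak order to the set of $s$-Tamari trees. Being a sublattice means being closed under the meet and join of the $s$-weak order. *)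

theory Defs
  imports "HOL-Algebra.Lattice"
begin

text \<open>Rooted planar trees: internal nodes carry a label and an ordered list of child subtrees.\<close>

datatype ptree = Leaf | Node nat "ptree list"

text \<open>Labels are collected in a list, so that repeated labels can be detected.\<close>

fun labels :: "ptree \<Rightarrow> nat list" where
  "labels Leaf = []"
| "labels (Node i ts) = i # concat (map labels ts)"

fun subtrees :: "ptree \<Rightarrow> ptree set" where
  "subtrees Leaf = {Leaf}"
| "subtrees (Node i ts) = insert (Node i ts) (\<Union>t\<in>set ts. subtrees t)"

text \<open>\<open>in_child T y i x\<close> is $x \in T^y_i$ (children are numbered from $0$).\<close>

definition in_child :: "ptree \<Rightarrow> nat \<Rightarrow> nat \<Rightarrow> nat \<Rightarrow> bool" where
  "in_child T y i x \<longleftrightarrow>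
    (\<exists>ts. Node y ts \<in> subtrees T \<and> i < length ts \<and> x \<in> set (labels (ts ! i)))"

text \<open>Descendants are proper.\<close>

definition descendant :: "ptree \<Rightarrow> nat \<Rightarrow> nat \<Rightarrow> bool" where
  "descendant T x y \<longleftrightarrow> (\<exists>i. in_child T y i x)"

text \<open>
  A weak composition $(s(1), \dots, s(n))$ is a list of natural numbers, with $n$ its length.
  Lists are indexed from $0$, so the entry $s(i)$ is shifted by one.
\<close>

definition entry :: "nat list \<Rightarrow> nat \<Rightarrow> nat" where
  "entry s i = s ! (i - 1)"

definition s_decreasing_tree :: "nat list \<Rightarrow> ptree \<Rightarrow> bool" where
  "s_decreasing_tree s T \<longleftrightarrow>
    distinct (labels T) \<and> set (labels T) = {1..length s} \<and>
    (\<forall>i ts. Node i ts \<in> subtrees T \<longrightarrow> length ts = entry s i + 1) \<and>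
    (\<forall>i j. descendant T j i \<longrightarrow> j < i)"

definition common_ancestor :: "ptree \<Rightarrow> nat \<Rightarrow> nat \<Rightarrow> nat \<Rightarrow> bool" where
  "common_ancestor T x y z \<longleftrightarrow> descendant T x z \<and> descendant T y z"

definition closest_common_ancestor :: "ptree \<Rightarrow> nat \<Rightarrow> nat \<Rightarrow> nat \<Rightarrow> bool" where
  "closest_common_ancestor T x y z \<longleftrightarrow>
    common_ancestor T x y z \<and> (\<forall>w. common_ancestor T x y w \<longrightarrow> \<not> descendant T w z)"

text \<open>
  If \<open>x\<close> is a descendant of \<open>y\<close>, then \<open>x\<close> and \<open>y\<close> lie in the same child subtree of every
  common ancestor, so neither of the following two relations holds.
\<close>

definition left_of :: "ptree \<Rightarrow> nat \<Rightarrow> nat \<Rightarrow> bool" where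
  "left_of T x y \<longleftrightarrow>
    (\<exists>z i j. closest_common_ancestor T x y z \<and> in_child T z j x \<and> in_child T z i y \<and> j < i)"

definition right_of :: "ptree \<Rightarrow> nat \<Rightarrow> nat \<Rightarrow> bool" where
  "right_of T x y \<longleftrightarrow>
    (\<exists>z i j. closest_common_ancestor T x y z \<and> in_child T z j x \<and> in_child T z i y \<and> j > i)"

text \<open>The cardinality $\#_T(y,x)$; it is meaningful for $1 \le x < y \le n$.\<close>

definition inv_card :: "nat list \<Rightarrow> ptree \<Rightarrow> nat \<Rightarrow> nat \<Rightarrow> nat" where
  "inv_card s T y x =
    (if left_of T x y then 0
     else if right_of T x y then entry s y
     else (THE i. in_child T y i x))"

definition s_weak_order :: "nat list \<Rightarrow> ptree gorder" where
  "s_weak_order s =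
    \<lparr>carrier = {T. s_decreasing_tree s T}, eq = (=),
     le = (\<lambda>R T. \<forall>x y. 1 \<le> x \<and> x < y \<and> y \<le> length s \<longrightarrow> inv_card s R y x \<le> inv_card s T y x)\<rparr>"

definition s_Tamari_tree :: "nat list \<Rightarrow> ptree \<Rightarrow> bool" where
  "s_Tamari_tree s T \<longleftrightarrow>
    s_decreasing_tree s T \<and>
    (\<forall>a b c. 1 \<le> a \<and> a < b \<and> b < c \<and> c \<le> length s \<longrightarrow> inv_card s T c a \<le> inv_card s T c b)"

definition s_Tamari_poset :: "nat list \<Rightarrow> ptree gorder" where
  "s_Tamari_poset s = (s_weak_order s)\<lparr>carrier := {T. s_Tamari_tree s T}\<rparr>"

text \<open>
  Closure of a subset under the join and meet of the ambient order. The library operations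
  \<open>join\<close> and \<open>meet\<close> are choice-based, hence arbitrary when no supremum or infimum exists; the
  \<open>least\<close> and \<open>greatest\<close> conditions state that they are the genuine supremum and infimum
  taken in \<open>L\<close>.
\<close>

definition sublattice :: "'a set \<Rightarrow> ('a, 'b) gorder_scheme \<Rightarrow> bool" where
  "sublattice H L \<longleftrightarrow>
    H \<subseteq> carrier L \<and>
    (\<forall>x\<in>H. \<forall>y\<in>H.
      least L (x \<squnion>\<^bsub>L\<^esub> y) (Upper L {x, y}) \<and> x \<squnion>\<^bsub>L\<^esub> y \<in> H \<and>
      greatest L (x \<sqinter>\<^bsub>L\<^esub> y) (Lower L {x, y}) \<and> x \<sqinter>\<^bsub>L\<^esub> y \<in> H)"

end

theory Submission
  imports Defs
begin

text \<open>
  The numbers \<open>#(y,x)\<close> of any decreasing tree are transitive: for \<open>a < b < c\<close>, \<open>#(b,a) > 0\<close> implies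
  \<open>#(c,b) \<le> #(c,a)\<close>. A bounded function that is transitive and monotone, \<open>#(c,a) \<le> #(c,b)\<close>, comes
  from a (unique) tree, so \<open>s\<close>-Tamari trees are the same as such functions. These are closed under
  pointwise infima, which gives meets. For joins one needs that the least Tamari function above
  \<open>R\<close> and \<open>T\<close> lies below every upper bound \<open>U\<close> in the weak order, Tamari or not: the function
  \<open>K(c,a) = min {#\<^sub>U(c,b) | a \<le> b < c}\<close> is Tamari, lies below \<open>U\<close>, and still dominates \<open>R\<close> and \<open>T\<close>
  because these are monotone.
\<close>

section \<open>Inversions of a tree in terms of its child subtrees\<close>

text \<open>Positions rather than elements are compared because several children may be equal
  leaves, all with the same empty label list.\<close>

lemma distinct_concat_nth_iff:
  "distinct (concat xss) \<longleftrightarrow>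
    (\<forall>i<length xss. distinct (xss ! i)) \<and>
    (\<forall>i<length xss. \<forall>j<length xss. i \<noteq> j \<longrightarrow> set (xss ! i) \<inter> set (xss ! j) = {})"
proof (induction xss)
  case (Cons xs xss)
  have "set xs \<inter> (\<Union>ys\<in>set xss. set ys) = {} \<longleftrightarrow>
      (\<forall>j<length xss. set xs \<inter> set (xss ! j) = {})"
    by (fastforce simp: in_set_conv_nth)
  moreover have "(\<forall>i<length (xs # xss). \<forall>j<length (xs # xss).
        i \<noteq> j \<longrightarrow> set ((xs # xss) ! i) \<inter> set ((xs # xss) ! j) = {}) \<longleftrightarrow>
      (\<forall>j<length xss. set xs \<inter> set (xss ! j) = {}) \<and>
      (\<forall>i<length xss. \<forall>j<length xss. i \<noteq> j \<longrightarrow> set (xss ! i) \<inter> set (xss ! j) = {})"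
    by (simp add: All_less_Suc2 Int_commute all_conj_distrib imp_conjR)
  ultimately show ?case
    using Cons by (simp add: All_less_Suc2 conj_ac)
qed simp

lemma mem_labels_Node:
  "x \<in> set (labels (Node z ts)) \<longleftrightarrow> x = z \<or> (\<exists>k<length ts. x \<in> set (labels (ts ! k)))"
  by (fastforce simp: in_set_conv_nth)

lemma in_child_Leaf [simp]: "\<not> in_child Leaf y i x"
  by (simp add: in_child_def)

lemma in_child_Node:
  "in_child (Node z ts) y i x \<longleftrightarrow>
    (y = z \<and> i < length ts \<and> x \<in> set (labels (ts ! i))) \<or> (\<exists>k<length ts. in_child (ts ! k) y i x)"
  unfolding in_child_def by (fastforce simp: in_set_conv_nth)

lemma in_child_labels:
  "in_child T y i x \<Longrightarrow> y \<in> set (labels T) \<and> x \<in> set (labels T)"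
proof (induction T)
  case (Node z ts)
  then show ?case
    unfolding in_child_Node mem_labels_Node by (metis nth_mem)
qed simp

lemma descendant_labels:
  "descendant T x y \<Longrightarrow> y \<in> set (labels T) \<and> x \<in> set (labels T)"
  unfolding descendant_def using in_child_labels by blast

text \<open>\<open>left_of\<close>, \<open>right_of\<close> and \<open>inv_card\<close> are defined
  globally, through ancestors in the whole tree. At a node with distinct labels they depend only on
  which children hold \<open>x\<close> and \<open>y\<close>, or reduce to the common child. This
  gives \<open>inv_card\<close> the recursion that drives all later inductions.\<close>

locale distinct_node =
  fixes z :: nat and ts :: "ptree list"
  assumes distinct: "distinct (labels (Node z ts))"
begin

lemma root_notin: "k < length ts \<Longrightarrow> z \<notin> set (labels (ts ! k))"
  using distinct by auto

lemma distinct_child: "k < length ts \<Longrightarrow> distinct (labels (ts ! k))"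
  using distinct by (simp add: distinct_concat_nth_iff)

lemma child_unique:
  "\<lbrakk>x \<in> set (labels (ts ! k)); x \<in> set (labels (ts ! l)); k < length ts; l < length ts\<rbrakk> \<Longrightarrow> k = l"
  using distinct by (fastforce simp: distinct_concat_nth_iff)

lemma in_child_root_iff:
  "in_child (Node z ts) z i x \<longleftrightarrow> i < length ts \<and> x \<in> set (labels (ts ! i))"
  unfolding in_child_Node using in_child_labels root_notin by blast

lemma in_child_child_iff:
  assumes "k < length ts" "y \<in> set (labels (ts ! k))"
  shows "in_child (Node z ts) y i x \<longleftrightarrow> in_child (ts ! k) y i x"
  unfolding in_child_Node using assms in_child_labels root_notin child_unique by blast

lemma descendant_root_iff:
  "descendant (Node z ts) x z \<longleftrightarrow> (\<exists>k<length ts. x \<in> set (labels (ts ! k)))"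
  unfolding descendant_def in_child_root_iff by blast

lemma descendant_child_iff:
  assumes "k < length ts" "y \<in> set (labels (ts ! k))"
  shows "descendant (Node z ts) x y \<longleftrightarrow> descendant (ts ! k) x y"
  unfolding descendant_def using in_child_child_iff[OF assms] by blast

lemma not_descendant_root: "\<not> descendant (Node z ts) z y"
  unfolding descendant_def in_child_Node using in_child_labels root_notin by blast

lemma descendant_cases:
  assumes "descendant (Node z ts) x y"
  obtains (root) "y = z" | (child) k where "k < length ts" "descendant (ts ! k) x y"
  using assms unfolding descendant_def in_child_Node by blast

lemma common_ancestor_same_iff:
  assumes k: "k < length ts" and x: "x \<in> set (labels (ts ! k))" and y: "y \<in> set (labels (ts ! k))"
  shows "common_ancestor (Node z ts) x y w \<longleftrightarrow> w = z \<or> common_ancestor (ts ! k) x y w"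
proof
  assume "common_ancestor (Node z ts) x y w"
  then have d: "descendant (Node z ts) x w" "descendant (Node z ts) y w"
    by (auto simp: common_ancestor_def)
  from d(1) show "w = z \<or> common_ancestor (ts ! k) x y w"
  proof (cases rule: descendant_cases)
    case (child l)
    then have "l = k"
      using descendant_labels child_unique k x by blast
    with child d show ?thesis
      unfolding common_ancestor_def using descendant_labels descendant_child_iff k by blast
  qed simp
next
  assume "w = z \<or> common_ancestor (ts ! k) x y w"
  then show "common_ancestor (Node z ts) x y w"
    unfolding common_ancestor_def
    using k x y descendant_root_iff descendant_child_iff descendant_labels by blast
qed

text \<open>An ancestor of \<open>x\<close> other than the root lies in the child that holds
  \<open>x\<close>, and all its descendants stay in that child.\<close>

lemma common_ancestor_diff_iff:
  assumes k: "k < length ts" and x: "x \<in> set (labels (ts ! k))"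
    and l: "l < length ts" and y: "y \<in> set (labels (ts ! l))" and "k \<noteq> l"
  shows "common_ancestor (Node z ts) x y w \<longleftrightarrow> w = z"
proof
  assume "common_ancestor (Node z ts) x y w"
  then have d: "descendant (Node z ts) x w" "descendant (Node z ts) y w"
    by (auto simp: common_ancestor_def)
  from d(1) show "w = z"
  proof (cases rule: descendant_cases)
    case (child m)
    then have "m = k"
      using descendant_labels child_unique k x by blast
    with child d have "descendant (ts ! k) y w"
      using descendant_labels descendant_child_iff by blast
    then show ?thesis
      using descendant_labels child_unique k l y \<open>k \<noteq> l\<close> by blast
  qed simp
next
  assume "w = z"
  then show "common_ancestor (Node z ts) x y w"
    unfolding common_ancestor_def using assms descendant_root_iff by blast
qed

lemma closest_common_ancestor_diff_iff:
  assumes "k < length ts" "x \<in> set (labels (ts ! k))" "l < length ts" "y \<in> set (labels (ts ! l))" "k \<noteq> l"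
  shows "closest_common_ancestor (Node z ts) x y w \<longleftrightarrow> w = z"
  unfolding closest_common_ancestor_def common_ancestor_diff_iff[OF assms]
  using not_descendant_root by blast

text \<open>The root is never a proper descendant, so its being a common ancestor does not
  disqualify \<open>w\<close>. As a value of \<open>w\<close> it has to be excluded: if
  \<open>y\<close> labels the root of the child, then \<open>z\<close> is the closest common
  ancestor in the whole tree, but not in the child.\<close>

lemma closest_common_ancestor_same_iff:
  assumes k: "k < length ts" and x: "x \<in> set (labels (ts ! k))" and y: "y \<in> set (labels (ts ! k))"
    and "w \<noteq> z"
  shows "closest_common_ancestor (Node z ts) x y w \<longleftrightarrow> closest_common_ancestor (ts ! k) x y w"
proof -
  have "descendant (Node z ts) v w \<longleftrightarrow> descendant (ts ! k) v w" if "common_ancestor (ts ! k) x y w" for v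
    using that descendant_child_iff k descendant_labels unfolding common_ancestor_def by blast
  then show ?thesis
    unfolding closest_common_ancestor_def common_ancestor_same_iff[OF k x y]
    using \<open>w \<noteq> z\<close> not_descendant_root by blast
qed

lemma left_right_diff:
  assumes "k < length ts" "x \<in> set (labels (ts ! k))" "l < length ts" "y \<in> set (labels (ts ! l))" "k \<noteq> l"
  shows "left_of (Node z ts) x y \<longleftrightarrow> k < l" and "right_of (Node z ts) x y \<longleftrightarrow> l < k"
  unfolding left_of_def right_of_def closest_common_ancestor_diff_iff[OF assms]
  using assms in_child_root_iff child_unique by (metis, metis)

lemma left_right_same:
  assumes k: "k < length ts" and x: "x \<in> set (labels (ts ! k))" and y: "y \<in> set (labels (ts ! k))"
  shows "left_of (Node z ts) x y \<longleftrightarrow> left_of (ts ! k) x y"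
    and "right_of (Node z ts) x y \<longleftrightarrow> right_of (ts ! k) x y"
proof -
  have "(closest_common_ancestor (Node z ts) x y w \<and> in_child (Node z ts) w j x \<and>
          in_child (Node z ts) w i y) \<longleftrightarrow>
        (closest_common_ancestor (ts ! k) x y w \<and> in_child (ts ! k) w j x \<and>
          in_child (ts ! k) w i y)" if "j < i \<or> i < j" for w i j
  \<comment> \<open>The root may be the closest common ancestor, but it sees both labels at index
    \<open>k\<close>, so it can witness neither left nor right; and it is no label of the
    child.\<close>
  proof (cases "w = z")
    case True
    have "i = j" if "in_child (Node z ts) z j x" "in_child (Node z ts) z i y"
      using that child_unique k x y unfolding in_child_root_iff by metis
    moreover have "\<not> in_child (ts ! k) z j x"
      using in_child_labels root_notin[OF k] by blast
    ultimately show ?thesis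
      using True that by blast
  next
    case False
    then show ?thesis
      using closest_common_ancestor_same_iff[OF k x y False] in_child_child_iff[OF k]
      unfolding closest_common_ancestor_def common_ancestor_def
      by (meson descendant_labels)
  qed
  then show "left_of (Node z ts) x y \<longleftrightarrow> left_of (ts ! k) x y"
    and "right_of (Node z ts) x y \<longleftrightarrow> right_of (ts ! k) x y"
    unfolding left_of_def right_of_def by (intro iff_exI; blast)+
qed

lemma inv_card_root:
  assumes "k < length ts" "x \<in> set (labels (ts ! k))"
  shows "inv_card s (Node z ts) z x = k"
proof -
  \<comment> \<open>The root has no proper ancestor, hence no common ancestor with \<open>x\<close>,
    and \<open>inv_card\<close> falls through to its last clause.\<close>
  have "\<not> left_of (Node z ts) x z" "\<not> right_of (Node z ts) x z"
    unfolding left_of_def right_of_def closest_common_ancestor_def common_ancestor_def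
    using not_descendant_root by blast+
  then show ?thesis
    unfolding inv_card_def in_child_root_iff
    using assms child_unique by (auto intro!: the_equality)
qed

lemma inv_card_same:
  assumes "k < length ts" "x \<in> set (labels (ts ! k))" "y \<in> set (labels (ts ! k))"
  shows "inv_card s (Node z ts) y x = inv_card s (ts ! k) y x"
  unfolding inv_card_def left_right_same[OF assms] in_child_child_iff[OF assms(1,3)] ..

lemma inv_card_left:
  assumes "k < length ts" "x \<in> set (labels (ts ! k))" "l < length ts" "y \<in> set (labels (ts ! l))" "k < l"
  shows "inv_card s (Node z ts) y x = 0"
  unfolding inv_card_def using left_right_diff[OF assms(1-4)] assms(5) by simp

lemma inv_card_right:
  assumes "k < length ts" "x \<in> set (labels (ts ! k))" "l < length ts" "y \<in> set (labels (ts ! l))" "l < k"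
  shows "inv_card s (Node z ts) y x = entry s y"
  unfolding inv_card_def using left_right_diff[OF assms(1-4)] assms(5) by simp

end

section \<open>Decreasing trees on arbitrary label sets\<close>

text \<open>A recursive form of \<open>s_decreasing_tree\<close> without the condition that the
  labels form an initial segment; unlike the original it passes to child subtrees.\<close>

fun decreasing :: "nat list \<Rightarrow> ptree \<Rightarrow> bool" where
  "decreasing s Leaf \<longleftrightarrow> True"
| "decreasing s (Node z ts) \<longleftrightarrow>
    length ts = entry s z + 1 \<and> distinct (labels (Node z ts)) \<and>
    (\<forall>t\<in>set ts. set (labels t) \<subseteq> {..<z} \<and> decreasing s t)"

lemma decreasing_iff:
  "distinct (labels T) \<Longrightarrow>
    decreasing s T \<longleftrightarrow>
      (\<forall>i ts. Node i ts \<in> subtrees T \<longrightarrow> length ts = entry s i + 1) \<and>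
      (\<forall>i j. descendant T j i \<longrightarrow> j < i)"
proof (induction T)
  case Leaf
  then show ?case by (simp add: descendant_def)
next
  case (Node z ts)
  have IH: "decreasing s t \<longleftrightarrow>
      (\<forall>i us. Node i us \<in> subtrees t \<longrightarrow> length us = entry s i + 1) \<and>
      (\<forall>i j. descendant t j i \<longrightarrow> j < i)" if "t \<in> set ts" for t
    using Node that by (auto simp: distinct_concat_iff)
  have desc: "(\<forall>i j. descendant (Node z ts) j i \<longrightarrow> j < i) \<longleftrightarrow>
      (\<forall>t\<in>set ts. set (labels t) \<subseteq> {..<z} \<and> (\<forall>i j. descendant t j i \<longrightarrow> j < i))"
    unfolding descendant_def in_child_Node all_set_conv_all_nth by blast
  have len: "(\<forall>i us. Node i us \<in> subtrees (Node z ts) \<longrightarrow> length us = entry s i + 1) \<longleftrightarrow>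
      length ts = entry s z + 1 \<and>
      (\<forall>t\<in>set ts. \<forall>i us. Node i us \<in> subtrees t \<longrightarrow> length us = entry s i + 1)"
    by auto
  show ?case
    unfolding decreasing.simps desc len using Node.prems IH by blast
qed

lemma s_decreasing_tree_iff:
  "s_decreasing_tree s T \<longleftrightarrow> decreasing s T \<and> set (labels T) = {1..length s}"
proof -
  have "decreasing s T \<Longrightarrow> distinct (labels T)"
    by (cases T) auto
  then show ?thesis
    unfolding s_decreasing_tree_def using decreasing_iff by blast
qed

locale decreasing_node =
  fixes s :: "nat list" and z :: nat and ts :: "ptree list"
  assumes decr: "decreasing s (Node z ts)"
begin

sublocale distinct_node z ts
  using decr by unfold_locales simp

lemma length_children: "length ts = entry s z + 1"
  using decr by simp

lemma child_decreasing: "k < length ts \<Longrightarrow> decreasing s (ts ! k)"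
  using decr by simp

lemma child_less_root: "\<lbrakk>k < length ts; x \<in> set (labels (ts ! k))\<rbrakk> \<Longrightarrow> x < z"
  using decr by (auto dest!: nth_mem)

lemma label_cases:
  assumes "x \<in> set (labels (Node z ts))"
  obtains (root) "x = z" | (child) k where "k < length ts" "x \<in> set (labels (ts ! k))" "x < z"
  using assms child_less_root unfolding mem_labels_Node by blast

lemma label_less_cases:
  assumes "x \<in> set (labels (Node z ts))" "y \<in> set (labels (Node z ts))" "x < y"
  obtains k where "k < length ts" "x \<in> set (labels (ts ! k))" "x < z"
  using assms child_less_root unfolding mem_labels_Node by (metis less_asym less_irrefl)

end

section \<open>Boundedness, transitivity and uniqueness of inversion numbers\<close>

text \<open>Descend to the node where \<open>y\<close> is the root or where \<open>x\<close> and
  \<open>y\<close> part into different children. There the number is a child index of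
  \<open>y\<close>, or 0, or \<open>entry s y\<close>.\<close>

lemma inv_card_le_entry:
  assumes "decreasing s T" "x \<in> set (labels T)" "y \<in> set (labels T)" "x < y"
  shows "inv_card s T y x \<le> entry s y"
  using assms
proof (induction T)
  case (Node z ts)
  interpret decreasing_node s z ts
    using Node.prems by unfold_locales
  obtain k where k: "k < length ts" "x \<in> set (labels (ts ! k))"
    using label_less_cases Node.prems by metis
  from Node.prems(3) show ?case
  proof (cases rule: label_cases)
    case root
    then show ?thesis
      using inv_card_root[OF k] k length_children by simp
  next
    case (child l)
    then consider "l = k" | "k < l" | "l < k" by linarith
    then show ?thesis
    proof cases
      case 1
      then have "inv_card s (ts ! k) y x \<le> entry s y"
        using Node child k child_decreasing by (metis nth_mem)
      then show ?thesis
        using 1 inv_card_same[OF k] child by simp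
    qed (use inv_card_left[OF k child(1,2)] inv_card_right[OF k child(1,2)] in auto)
  qed
qed simp

text \<open>A positive number means that \<open>a\<close> is not left of \<open>b\<close>, so the
  child of \<open>a\<close> has index at least that of \<open>b\<close>. If \<open>c\<close> is the
  root, these indices are the two numbers compared. Otherwise, if \<open>b\<close> is left of
  \<open>c\<close>, the left side is 0; if \<open>a\<close> is right of \<open>c\<close>, the right
  side is maximal; in the remaining case all three share a child and induction applies.\<close>

lemma inv_card_transitive:
  assumes "decreasing s T" "a \<in> set (labels T)" "b \<in> set (labels T)" "c \<in> set (labels T)"
    and "a < b" "b < c" "0 < inv_card s T b a"
  shows "inv_card s T c b \<le> inv_card s T c a"
  using assms
proof (induction T)
  case (Node z ts)
  interpret decreasing_node s z ts
    using Node.prems by unfold_locales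
  obtain i where i: "i < length ts" "a \<in> set (labels (ts ! i))"
    using label_less_cases Node.prems by metis
  obtain j where j: "j < length ts" "b \<in> set (labels (ts ! j))"
    using label_less_cases Node.prems by metis
  have "j \<le> i"
    using inv_card_left[OF i j] Node.prems(7) by (metis less_irrefl not_le)
  from Node.prems(4) show ?case
  proof (cases rule: label_cases)
    case root
    then show ?thesis
      using inv_card_root[OF i] inv_card_root[OF j] \<open>j \<le> i\<close> by simp
  next
    case (child k)
    have le: "inv_card s (Node z ts) c b \<le> entry s c"
      using inv_card_le_entry Node.prems by metis
    consider "j < k" | "k < i" | "j = k" "i = k"
      using \<open>j \<le> i\<close> by linarith
    then show ?thesis
    proof cases
      case 1
      then show ?thesis
        using inv_card_left[OF j child(1,2)] by simp
    next
      case 2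
      then show ?thesis
        using inv_card_right[OF i child(1,2)] le by simp
    next
      case 3
      have *: "inv_card s (Node z ts) c b = inv_card s (ts ! k) c b"
        "inv_card s (Node z ts) c a = inv_card s (ts ! k) c a"
        "inv_card s (Node z ts) b a = inv_card s (ts ! k) b a"
        using inv_card_same child i j 3 by blast+
      have "inv_card s (ts ! k) c b \<le> inv_card s (ts ! k) c a"
        using Node.IH[of "ts ! k"] Node.prems(5-7) child_decreasing child i j 3 * by simp
      then show ?thesis
        using * by simp
    qed
  qed
qed simp

text \<open>The root is the largest label, and the numbers of the root with the other labels say
  which child holds each of them. So corresponding children have equal label sets, and induction
  applies to them; a child without labels is a leaf.\<close>

lemma decreasing_eqI:
  assumes "decreasing s T" "decreasing s T'" "set (labels T) = set (labels T')"
    and "\<And>x y. \<lbrakk>x \<in> set (labels T); y \<in> set (labels T); x < y\<rbrakk> \<Longrightarrow> inv_card s T y x = inv_card s T' y x"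
  shows "T = T'"
  using assms
proof (induction T arbitrary: T')
  case Leaf
  then show ?case by (cases T') auto
next
  case (Node z ts)
  interpret T: decreasing_node s z ts
    using Node.prems by unfold_locales
  obtain z' ts' where T': "T' = Node z' ts'"
    using Node.prems(3) by (cases T') auto
  interpret T': decreasing_node s z' ts'
    using Node.prems T' by unfold_locales simp
  have z': "z' = z"
    using Node.prems(3) T.label_cases[of z'] T'.label_cases[of z] unfolding T'
    by (metis labels.simps(2) less_asym list.set_intros(1))
  have len: "length ts' = length ts"
    using T.length_children T'.length_children z' by simp
  have child_labels: "set (labels (ts ! k)) = set (labels (ts' ! k))" if k: "k < length ts" for k
  proof -
    have "x \<in> set (labels (ts ! k)) \<longleftrightarrow> x \<in> set (labels (ts' ! k))" for x
    proof (cases "x \<in> set (labels (Node z ts)) \<and> x \<noteq> z")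
      case True
      obtain i where i: "i < length ts" "x \<in> set (labels (ts ! i))" "x < z"
        using True T.label_cases[of x] by metis
      obtain i' where i': "i' < length ts" "x \<in> set (labels (ts' ! i'))"
        using True T'.label_cases[of x] Node.prems(3) T' z' len by metis
      have "i = i'"
        using Node.prems(4)[of x z] True i i' T.inv_card_root[OF i(1,2)] T'.inv_card_root[of i'] T' z' len
        by simp
      then show ?thesis
        using T.child_unique T'.child_unique i i' k len by metis
    next
      case False
      then show ?thesis
        using k len T.root_notin T'.root_notin z' Node.prems(3) T' mem_labels_Node by metis
    qed
    then show ?thesis by blast
  qed
  have "ts ! k = ts' ! k" if k: "k < length ts" for k
  proof (rule Node.IH)
    show "ts ! k \<in> set ts" "decreasing s (ts ! k)" "decreasing s (ts' ! k)"
      using k len T.child_decreasing T'.child_decreasing by simp_all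
    show "set (labels (ts ! k)) = set (labels (ts' ! k))"
      using child_labels[OF k] .
  next
    fix x y assume xy: "x \<in> set (labels (ts ! k))" "y \<in> set (labels (ts ! k))" "x < y"
    then have "inv_card s (Node z ts) y x = inv_card s T' y x"
      using Node.prems(4) k mem_labels_Node by metis
    then show "inv_card s (ts ! k) y x = inv_card s (ts' ! k) y x"
      using T.inv_card_same T'.inv_card_same T' z' len k xy child_labels by simp
  qed
  then show ?case
    using T' z' len by (metis nth_equalityI)
qed

section \<open>Tamari inversion functions\<close>

text \<open>The label set \<open>A\<close> is a parameter because trees are rebuilt by induction on
  subsets. Only values \<open>I c a\<close> with \<open>a < c\<close> in \<open>A\<close> are
  constrained. The last two conditions together say that \<open>0 < I b a\<close> forces
  \<open>I c a = I c b\<close>.\<close>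

definition Tamari_inversions :: "nat list \<Rightarrow> nat set \<Rightarrow> (nat \<Rightarrow> nat \<Rightarrow> nat) \<Rightarrow> bool" where
  "Tamari_inversions s A I \<longleftrightarrow>
    (\<forall>a\<in>A. \<forall>c\<in>A. a < c \<longrightarrow> I c a \<le> entry s c) \<and>
    (\<forall>a\<in>A. \<forall>b\<in>A. \<forall>c\<in>A. a < b \<and> b < c \<longrightarrow>
      I c a \<le> I c b \<and> (0 < I b a \<longrightarrow> I c b \<le> I c a))"

lemma Tamari_inversionsD:
  assumes "Tamari_inversions s A I"
  shows "\<lbrakk>a \<in> A; c \<in> A; a < c\<rbrakk> \<Longrightarrow> I c a \<le> entry s c"
    and "\<lbrakk>a \<in> A; b \<in> A; c \<in> A; a < b; b < c\<rbrakk> \<Longrightarrow> I c a \<le> I c b"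
    and "\<lbrakk>a \<in> A; b \<in> A; c \<in> A; a < b; b < c; 0 < I b a\<rbrakk> \<Longrightarrow> I c b \<le> I c a"
  using assms unfolding Tamari_inversions_def by simp_all

lemma Tamari_inversions_subset:
  "\<lbrakk>Tamari_inversions s A I; B \<subseteq> A\<rbrakk> \<Longrightarrow> Tamari_inversions s B I"
  unfolding Tamari_inversions_def by blast

text \<open>
  The children of the largest label \<open>z\<close> are the level sets of \<open>I z\<close>. Monotonicity says that a
  smaller label never lies to the right of a larger one, and transitivity that it has no
  inversion with a larger one lying strictly to its right.
\<close>

lemma Tamari_inversions_realizable:
  assumes "finite A" "Tamari_inversions s A I"
  shows "\<exists>T. decreasing s T \<and> set (labels T) = A \<and>
    (\<forall>x\<in>A. \<forall>y\<in>A. x < y \<longrightarrow> inv_card s T y x = I y x)"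
  using assms
proof (induction A rule: finite_psubset_induct)
  case (psubset A)
  show ?case
  proof (cases "A = {}")
    case True
    then show ?thesis
      by (intro exI[of _ Leaf]) simp
  next
    case False
    define z where "z = Max A"
    have z: "z \<in> A" and z_max: "\<And>x. x \<in> A \<Longrightarrow> x \<noteq> z \<Longrightarrow> x < z"
      using psubset.hyps False unfolding z_def by (simp_all add: le_neq_implies_less)
    define B where "B i = {x \<in> A. x \<noteq> z \<and> I z x = i}" for i
    have "\<exists>T. decreasing s T \<and> set (labels T) = B i \<and>
        (\<forall>x\<in>B i. \<forall>y\<in>B i. x < y \<longrightarrow> inv_card s T y x = I y x)" for i
    proof (rule psubset.IH)
      show "B i \<subset> A"
        using z unfolding B_def by blast
      then show "Tamari_inversions s (B i) I"
        using psubset.prems Tamari_inversions_subset by blast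
    qed
    then obtain t where t: "\<And>i. decreasing s (t i)" "\<And>i. set (labels (t i)) = B i"
      "\<And>i x y. \<lbrakk>x \<in> B i; y \<in> B i; x < y\<rbrakk> \<Longrightarrow> inv_card s (t i) y x = I y x"
      by metis
    \<comment> \<open>As \<open>I z x\<close> is at most \<open>entry s z\<close>, these
      \<open>entry s z + 1\<close> positions collect all labels other than \<open>z\<close>; an
      empty level set contributes a leaf.\<close>
    define ts where "ts = map t [0..<entry s z + 1]"
    have len: "length ts = entry s z + 1" and nth: "\<And>i. i < length ts \<Longrightarrow> ts ! i = t i"
      unfolding ts_def by (simp_all del: upt_Suc)
    have index: "I z x < length ts" "x \<in> B (I z x)" if "x \<in> A" "x \<noteq> z" for x
      using that psubset.prems z z_max unfolding B_def Tamari_inversions_def len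
      by (auto simp: less_Suc_eq_le)
    have disj: "B i \<inter> B j = {}" if "i \<noteq> j" for i j
      using that unfolding B_def by blast
    have "distinct (labels (t i))" for i
      using t(1)[of i] by (cases "t i") auto
    then have "distinct (concat (map labels ts))"
      unfolding distinct_concat_nth_iff using disj nth t(2) by simp
    moreover have "z \<notin> (\<Union>t\<in>set ts. set (labels t))"
      using t(2) unfolding ts_def B_def by auto
    moreover have "\<forall>t\<in>set ts. set (labels t) \<subseteq> {..<z} \<and> decreasing s t"
      using t(1,2) z_max unfolding ts_def B_def by auto
    ultimately have decr: "decreasing s (Node z ts)"
      using len by simp
    then interpret decreasing_node s z ts
      by unfold_locales
    have labels: "set (labels (Node z ts)) = A"
    proof -
      have "x \<in> set (labels (Node z ts)) \<longleftrightarrow> x \<in> A" for x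
        unfolding mem_labels_Node using index[of x] nth t(2) z unfolding B_def by auto
      then show ?thesis by blast
    qed
    have "inv_card s (Node z ts) y x = I y x" if xy: "x \<in> A" "y \<in> A" "x < y" for x y
    proof -
      have "x \<noteq> z"
        using xy z_max by (metis less_asym)
      then have x: "I z x < length ts" "x \<in> set (labels (ts ! I z x))"
        using index[of x] xy nth t(2) by auto
      show ?thesis
      proof (cases "y = z")
        case True
        then show ?thesis
          using inv_card_root[OF x] by simp
      next
        case False
        then have y: "I z y < length ts" "y \<in> set (labels (ts ! I z y))"
          using index[of y] xy nth t(2) by auto
        have tam: "I z x \<le> I z y" "0 < I y x \<Longrightarrow> I z y \<le> I z x"
          using psubset.prems xy z z_max[OF _ False] unfolding Tamari_inversions_def by blast+
        show ?thesis
        proof (cases "I z x = I z y")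
          case True
          then show ?thesis
            using inv_card_same[OF x, of y s] x y t(3)[of x "I z x" y] xy nth t(2) by auto
        next
          case False
          then show ?thesis
            using inv_card_left[OF x y] tam by (cases "I y x") auto
        qed
      qed
    qed
    with decr labels show ?thesis
      by blast
  qed
qed

section \<open>The order on trees\<close>

lemma le_weak_iff:
  "R \<sqsubseteq>\<^bsub>s_weak_order s\<^esub> T \<longleftrightarrow>
    (\<forall>x\<in>{1..length s}. \<forall>y\<in>{1..length s}. x < y \<longrightarrow> inv_card s R y x \<le> inv_card s T y x)"
  unfolding s_weak_order_def by auto

lemma carrier_weak:
  "T \<in> carrier (s_weak_order s) \<longleftrightarrow> decreasing s T \<and> set (labels T) = {1..length s}"
  by (simp add: s_weak_order_def s_decreasing_tree_iff)

lemma Tamari_tree_iff: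
  "s_Tamari_tree s T \<longleftrightarrow>
    T \<in> carrier (s_weak_order s) \<and> Tamari_inversions s {1..length s} (inv_card s T)"
  (is "_ \<longleftrightarrow> _ \<and> Tamari_inversions s ?A _")
proof -
  have "(\<forall>a b c. 1 \<le> a \<and> a < b \<and> b < c \<and> c \<le> length s \<longrightarrow> inv_card s T c a \<le> inv_card s T c b) \<longleftrightarrow>
      Tamari_inversions s ?A (inv_card s T)" (is "?mono \<longleftrightarrow> _")
    if "decreasing s T" "set (labels T) = ?A"
  proof
    assume ?mono
    then show "Tamari_inversions s ?A (inv_card s T)"
      unfolding Tamari_inversions_def
      using inv_card_le_entry[OF that(1)] inv_card_transitive[OF that(1)] that(2) by simp
  next
    assume "Tamari_inversions s ?A (inv_card s T)"
    then show ?mono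
      unfolding Tamari_inversions_def by auto
  qed
  then show ?thesis
    unfolding s_Tamari_tree_def s_decreasing_tree_iff carrier_weak by blast
qed

lemma Tamari_tree_realizing:
  assumes "Tamari_inversions s {1..length s} I"
  obtains T where "s_Tamari_tree s T"
    "\<And>x y. \<lbrakk>x \<in> {1..length s}; y \<in> {1..length s}; x < y\<rbrakk> \<Longrightarrow> inv_card s T y x = I y x"
proof -
  obtain T where T: "decreasing s T" "set (labels T) = {1..length s}"
    "\<And>x y. \<lbrakk>x \<in> {1..length s}; y \<in> {1..length s}; x < y\<rbrakk> \<Longrightarrow> inv_card s T y x = I y x"
    using Tamari_inversions_realizable[OF _ assms] by auto
  then have "Tamari_inversions s {1..length s} (inv_card s T)"
    using assms unfolding Tamari_inversions_def by simp
  then show ?thesis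
    using that T unfolding Tamari_tree_iff carrier_weak by blast
qed

lemma partial_order_weak: "partial_order (s_weak_order s)"
proof
  fix Q R T assume "Q \<sqsubseteq>\<^bsub>s_weak_order s\<^esub> R" "R \<sqsubseteq>\<^bsub>s_weak_order s\<^esub> T"
  then show "Q \<sqsubseteq>\<^bsub>s_weak_order s\<^esub> T"
    unfolding le_weak_iff by (meson order_trans)
next
  fix R T assume "R \<sqsubseteq>\<^bsub>s_weak_order s\<^esub> T" "T \<sqsubseteq>\<^bsub>s_weak_order s\<^esub> R"
    "R \<in> carrier (s_weak_order s)" "T \<in> carrier (s_weak_order s)"
  then have "R = T"
    using decreasing_eqI[of s R T] unfolding le_weak_iff carrier_weak by (simp add: order_antisym)
  then show "R .=\<^bsub>s_weak_order s\<^esub> T"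
    by (simp add: s_weak_order_def)
qed (auto simp: s_weak_order_def)

lemma Tamari_inversions_min:
  assumes "Tamari_inversions s A I" "Tamari_inversions s A J"
  shows "Tamari_inversions s A (\<lambda>c a. min (I c a) (J c a))"
  using assms unfolding Tamari_inversions_def
  by (auto simp: min_le_iff_disj)

lemma Tamari_inversions_Inf:
  assumes "F \<noteq> {}" and F: "\<And>I. I \<in> F \<Longrightarrow> Tamari_inversions s A I"
  shows "Tamari_inversions s A (\<lambda>c a. INF I\<in>F. I c a)"
proof -
  have lower: "(INF I\<in>F. I c a) \<le> I c a" if "I \<in> F" for I :: "nat \<Rightarrow> nat \<Rightarrow> nat" and c a
    using that by (auto intro: cINF_lower)
  have greatest: "m \<le> (INF I\<in>F. I c a)" if "\<And>I. I \<in> F \<Longrightarrow> m \<le> I c a" for m c a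
    using that \<open>F \<noteq> {}\<close> by (auto intro: cINF_greatest)
  show ?thesis
    unfolding Tamari_inversions_def
  proof (intro conjI ballI impI)
    fix a c assume "a \<in> A" "c \<in> A" "a < c"
    moreover obtain I where "I \<in> F" using \<open>F \<noteq> {}\<close> by blast
    ultimately show "(INF I\<in>F. I c a) \<le> entry s c"
      using F[of I] lower[of I c a] unfolding Tamari_inversions_def by (meson order_trans)
  next
    fix a b c assume abc: "a \<in> A" "b \<in> A" "c \<in> A" "a < b \<and> b < c"
    then have *: "I c a \<le> I c b" if "I \<in> F" for I
      using Tamari_inversionsD(2)[OF F[OF that]] abc by blast
    show "(INF I\<in>F. I c a) \<le> (INF I\<in>F. I c b)"
      by (rule greatest) (rule order_trans[OF lower *])
    assume "0 < (INF I\<in>F. I b a)"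
    then have "0 < I b a" if "I \<in> F" for I
      using lower[OF that, of b a] by linarith
    then have *: "I c b \<le> I c a" if "I \<in> F" for I
      using Tamari_inversionsD(3)[OF F[OF that]] that abc by blast
    show "(INF I\<in>F. I c b) \<le> (INF I\<in>F. I c a)"
      by (rule greatest) (rule order_trans[OF lower *])
  qed
qed

lemma Tamari_inversions_below:
  assumes "decreasing s U" "set (labels U) = A"
    and I: "\<And>a b c. \<lbrakk>a \<in> A; b \<in> A; c \<in> A; a \<le> b; b < c\<rbrakk> \<Longrightarrow> I c a \<le> inv_card s U c b"
  obtains K where "Tamari_inversions s A K"
    "\<And>a c. \<lbrakk>a \<in> A; c \<in> A; a < c\<rbrakk> \<Longrightarrow> I c a \<le> K c a \<and> K c a \<le> inv_card s U c a"
proof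
  let ?K = "\<lambda>c a. INF b\<in>{b\<in>A. a \<le> b \<and> b < c}. inv_card s U c b"
  have lower: "?K c a \<le> inv_card s U c b" if "b \<in> A" "a \<le> b" "b < c" for a b c
    using that by (auto intro!: cINF_lower)
  have greatest: "m \<le> ?K c a"
    if "a \<in> A" "a < c" "\<And>b. \<lbrakk>b \<in> A; a \<le> b; b < c\<rbrakk> \<Longrightarrow> m \<le> inv_card s U c b" for m a c
    using that by (intro cINF_greatest) auto
  show "I c a \<le> ?K c a \<and> ?K c a \<le> inv_card s U c a" if "a \<in> A" "c \<in> A" "a < c" for a c
    using that I by (auto intro: lower greatest)
  show "Tamari_inversions s A ?K"
    unfolding Tamari_inversions_def
  proof (intro conjI ballI impI)
    fix a c assume ac: "a \<in> A" "c \<in> A" "a < c"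
    then show "?K c a \<le> entry s c"
      using lower[of a a c] inv_card_le_entry[OF assms(1), of a c] assms(2) by force
  next
    fix a b c assume abc: "a \<in> A" "b \<in> A" "c \<in> A" "a < b \<and> b < c"
    then show "?K c a \<le> ?K c b"
      by (intro greatest lower) auto
    assume pos: "0 < ?K b a"
    show "?K c b \<le> ?K c a"
    proof (rule greatest)
      fix d assume d: "d \<in> A" "a \<le> d" "d < c"
      show "?K c b \<le> inv_card s U c d"
      proof (cases "d < b")
        case True
        have "0 < inv_card s U b d"
          using pos lower[of d a b] d True by linarith
        then have "inv_card s U c b \<le> inv_card s U c d"
          using inv_card_transitive[OF assms(1)] assms(2) abc d True by blast
        moreover have "?K c b \<le> inv_card s U c b"
          using lower abc by blast
        ultimately show ?thesis by linarith
      next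
        case False
        then show ?thesis
          using lower d by simp
      qed
    qed (use abc in auto)
  qed
qed

section \<open>Meets and joins\<close>

lemma Tamari_meet_exists:
  assumes "s_Tamari_tree s R" "s_Tamari_tree s T"
  obtains M where "s_Tamari_tree s M" "greatest (s_weak_order s) M (Lower (s_weak_order s) {R, T})"
proof -
  have "Tamari_inversions s {1..length s} (\<lambda>y x. min (inv_card s R y x) (inv_card s T y x))"
    using assms Tamari_inversions_min unfolding Tamari_tree_iff by blast
  then obtain M where M: "s_Tamari_tree s M"
    "\<And>x y. \<lbrakk>x \<in> {1..length s}; y \<in> {1..length s}; x < y\<rbrakk> \<Longrightarrow>
      inv_card s M y x = min (inv_card s R y x) (inv_card s T y x)"
    by (rule Tamari_tree_realizing) blast
  have "greatest (s_weak_order s) M (Lower (s_weak_order s) {R, T})"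
    using M assms unfolding greatest_def Lower_def Tamari_tree_iff le_weak_iff by simp
  with M that show ?thesis by blast
qed

lemma Tamari_join_exists:
  assumes "s_Tamari_tree s R" "s_Tamari_tree s T"
  obtains J where "s_Tamari_tree s J" "least (s_weak_order s) J (Upper (s_weak_order s) {R, T})"
proof -
  define A where "A = {1..length s}"
  have RT: "Tamari_inversions s A (inv_card s R)" "Tamari_inversions s A (inv_card s T)"
    using assms unfolding Tamari_tree_iff A_def by auto
  define F where "F = {I. Tamari_inversions s A I \<and>
    (\<forall>x\<in>A. \<forall>y\<in>A. x < y \<longrightarrow> inv_card s R y x \<le> I y x \<and> inv_card s T y x \<le> I y x)}"
  have "(\<lambda>y x. entry s y) \<in> F"
    using RT unfolding F_def Tamari_inversions_def by auto
  then have "F \<noteq> {}" by blast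
  then have "Tamari_inversions s A (\<lambda>c a. INF I\<in>F. I c a)"
    by (rule Tamari_inversions_Inf) (simp add: F_def)
  then obtain J where J: "s_Tamari_tree s J"
    "\<And>x y. \<lbrakk>x \<in> A; y \<in> A; x < y\<rbrakk> \<Longrightarrow> inv_card s J y x = (INF I\<in>F. I y x)"
    unfolding A_def by (rule Tamari_tree_realizing) blast
  have "R \<sqsubseteq>\<^bsub>s_weak_order s\<^esub> J" "T \<sqsubseteq>\<^bsub>s_weak_order s\<^esub> J"
    unfolding le_weak_iff A_def[symmetric] using J(2) \<open>F \<noteq> {}\<close>
    by (auto intro!: cINF_greatest simp: F_def)
  moreover have "J \<sqsubseteq>\<^bsub>s_weak_order s\<^esub> U"
    if U: "U \<in> carrier (s_weak_order s)" "R \<sqsubseteq>\<^bsub>s_weak_order s\<^esub> U" "T \<sqsubseteq>\<^bsub>s_weak_order s\<^esub> U" for U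
  proof -
    have decr: "decreasing s U" "set (labels U) = A"
      using U(1) unfolding carrier_weak A_def by auto
    have "max (inv_card s R c a) (inv_card s T c a) \<le> inv_card s U c b"
      if abc: "a \<in> A" "b \<in> A" "c \<in> A" "a \<le> b" "b < c" for a b c
    proof -
      have "inv_card s R c a \<le> inv_card s R c b" "inv_card s T c a \<le> inv_card s T c b"
        using RT abc unfolding Tamari_inversions_def by (cases "a = b"; simp)+
      moreover have "inv_card s R c b \<le> inv_card s U c b" "inv_card s T c b \<le> inv_card s U c b"
        using U(2,3) abc unfolding le_weak_iff A_def by auto
      ultimately show ?thesis by linarith
    qed
    then obtain K where K: "Tamari_inversions s A K"
      "\<And>a c. \<lbrakk>a \<in> A; c \<in> A; a < c\<rbrakk> \<Longrightarrow>
        max (inv_card s R c a) (inv_card s T c a) \<le> K c a \<and> K c a \<le> inv_card s U c a"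
      using Tamari_inversions_below[OF decr, of "\<lambda>c a. max (inv_card s R c a) (inv_card s T c a)"]
      by metis
    then have "K \<in> F"
      unfolding F_def by auto
    then have "(INF I\<in>F. I y x) \<le> K y x" for x y
      by (auto intro: cINF_lower)
    then show ?thesis
      unfolding le_weak_iff A_def[symmetric] using J(2) K(2) by (metis order_trans)
  qed
  ultimately have "least (s_weak_order s) J (Upper (s_weak_order s) {R, T})"
    using J(1) assms unfolding least_def Upper_def Tamari_tree_iff by auto
  with J that show ?thesis by blast
qed

lemma (in partial_order) sublatticeI:
  assumes "H \<subseteq> carrier L"
    and join: "\<And>x y. \<lbrakk>x \<in> H; y \<in> H\<rbrakk> \<Longrightarrow> \<exists>j\<in>H. least L j (Upper L {x, y})"
    and meet: "\<And>x y. \<lbrakk>x \<in> H; y \<in> H\<rbrakk> \<Longrightarrow> \<exists>m\<in>H. greatest L m (Lower L {x, y})"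
  shows "sublattice H L"
  unfolding sublattice_def
proof (intro conjI ballI)
  fix x y assume xy: "x \<in> H" "y \<in> H"
  obtain j where j: "j \<in> H" "least L j (Upper L {x, y})"
    using join xy by blast
  then show "least L (x \<squnion> y) (Upper L {x, y})"
    unfolding join_def sup_def by (metis someI)
  with j show "x \<squnion> y \<in> H"
    using least_unique by metis
  obtain m where m: "m \<in> H" "greatest L m (Lower L {x, y})"
    using meet xy by blast
  then show "greatest L (x \<sqinter> y) (Lower L {x, y})"
    unfolding meet_def inf_def by (metis someI)
  with m show "x \<sqinter> y \<in> H"
    using greatest_unique by metis
qed (rule assms)

lemma (in partial_order) sublattice_imp_lattice:
  assumes "sublattice H L"
  shows "lattice (L\<lparr>carrier := H\<rparr>)"
proof -
  let ?H = "L\<lparr>carrier := H\<rparr>"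
  have HL: "\<And>x. x \<in> H \<Longrightarrow> x \<in> carrier L"
    using assms unfolding sublattice_def by blast
  interpret H: partial_order ?H
    by unfold_locales (auto simp: HL eq_is_equal dest: HL intro: le_trans le_antisym)
  show ?thesis
  proof
    fix x y assume "x \<in> carrier ?H" "y \<in> carrier ?H"
    then have xy: "x \<in> H" "y \<in> H" by simp_all
    have bounds: "Upper ?H {x, y} = Upper L {x, y} \<inter> H" "Lower ?H {x, y} = Lower L {x, y} \<inter> H"
      using xy HL unfolding Upper_def Lower_def by auto
    have "least L (x \<squnion> y) (Upper L {x, y})" "x \<squnion> y \<in> H"
      "greatest L (x \<sqinter> y) (Lower L {x, y})" "x \<sqinter> y \<in> H"
      using assms xy unfolding sublattice_def by blast+
    then have "least ?H (x \<squnion> y) (Upper ?H {x, y})" "greatest ?H (x \<sqinter> y) (Lower ?H {x, y})"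
      unfolding bounds by (simp_all add: least_def greatest_def)
    then show "\<exists>j. least ?H j (Upper ?H {x, y})" "\<exists>m. greatest ?H m (Lower ?H {x, y})"
      by blast+
  qed
qed

theorem theorem2p2:
  fixes s :: "nat list"
  shows "sublattice (carrier (s_Tamari_poset s)) (s_weak_order s) \<and> lattice (s_Tamari_poset s)"
proof -
  interpret partial_order "s_weak_order s"
    by (rule partial_order_weak)
  have "sublattice {T. s_Tamari_tree s T} (s_weak_order s)"
  proof (rule sublatticeI)
    show "{T. s_Tamari_tree s T} \<subseteq> carrier (s_weak_order s)"
      using Tamari_tree_iff by blast
  qed (use Tamari_join_exists Tamari_meet_exists in \<open>metis mem_Collect_eq\<close>)+
  then show ?thesis
    using sublattice_imp_lattice unfolding s_Tamari_poset_def by simp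
qed

end
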